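(* Let $D_S$ be a digraph with self-loops of order $n$ with $\sigma$ self-loops. Let $D_1,\dots,D_k$ be its strong components, where $D_i$ has order $n_i$ and $\sigma_i$ self-loops, such that $n=\sum_{i=1}^k n_i$ and $\sigma=\sum_{i=1}^k\sigma_i$, and let $\lambda_{i,1},\dots,\lambda_{i,n_i}$ be the eigenvalues of $A(D_i)$. Let $1\le l<k$ and suppose that $\frac{\sigma_i}{n_i}>\frac{\sigma}{n}$ for $i=1,\dots,l$ and $\frac{\sigma_i}{n_i}\le\frac{\sigma}{n}$ for $i=l+1,\dots,k$. For each $i$ let $$A_i=\left\{j\in\{1,\dots,n_i\}:\Re(\lambda_{i,j})>\frac{\sigma}{n}\right\}.$$ Then $$\sum_{i=1}^l\left(\frac{\sigma_i}{n_i}-\frac{\sigma}{n}\right)|A_i|\le\sum_{i=l+1}^k\left(\frac{\sigma}{n}-\frac{\sigma_i}{n_i}\right)|A_i|\quad\Longrightarrow\quad E(D_S)\le\sum_{i=1}^kE(D_i).$$ Moreover, if the inequality on the left-hand side of the implication is strict, then the inequality on the right-hand side is also strict.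
   Context: A digraph with self-loops $D_S$ is a pair $(V,\mathcal A)$ with $V$ a nonempty finite vertex set and $\mathcal A\subseteq V\times V$ a set of arcs; $S=\{v\in V:(v,v)\in\mathcal A\}$ is the self-loop set (possibly empty). The order is $n=|V|$ and the number of self-loops is $\sigma=|S|$. The adjacency matrix $A(D_S)=(a_{ij})$ has $a_{ij}=1$ if $(v_i,v_j)\in\mathcal A$ and $a_{ij}=0$ otherwise; eigenvalues are counted with algebraic multiplicity. The energy of a digraph with self-loops of order $n$ with $\sigma$ self-loops and eigenvalues $\lambda_1,\dots,\lambda_n$ is $\sum_{i=1}^n\left|\Re(\lambda_i)-\frac{\sigma}{n}\right|$; in particular $E(D_i)=\sum_{j=1}^{n_i}\left|\Re(\lambda_{i,j})-\frac{\sigma_i}{n_i}\right|$. A digraph is strongly connected if for any two distinct vertices $v,w$ there is a path from $v$ to $w$ and one from $w$ to $v$; a strong component is a maximal strongly connected sub-digraph (self-loops included). *)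

theory Defs
  imports
    "Graph_Theory.Graph_Theory"
    "Jordan_Normal_Form.Char_Poly"
    "HOL-Computational_Algebra.Computational_Algebra"
begin

text \<open>
  A digraph with self-loops \<open>(V, \<A>)\<close> with \<open>\<A> \<subseteq> V \<times> V\<close> is a \<open>pair_pre_digraph\<close> satisfying
  \<open>pair_fin_digraph\<close>. Its strong components are elements of \<open>sccs\<close>, which have type \<open>pre_digraph\<close>,
  so the notions below are stated for \<open>pre_digraph\<close> and apply to both.
\<close>

definition self_loops :: "('a,'b) pre_digraph \<Rightarrow> 'a set" where
  "self_loops G = {v \<in> verts G. (v, v) \<in> arcs_ends G}"

text \<open>The adjacency matrix with respect to the labelling of the vertices by the list \<open>vs\<close>.\<close>

definition adjacency_matrix :: "('a,'b) pre_digraph \<Rightarrow> 'a list \<Rightarrow> complex mat" where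
  "adjacency_matrix G vs = mat (length vs) (length vs)
     (\<lambda>(i, j). if (vs ! i, vs ! j) \<in> arcs_ends G then 1 else 0)"

text \<open>
  Eigenvalues with algebraic multiplicity. The labelling is chosen arbitrarily; by
  \<open>eigenvalues_eq\<close> below the result does not depend on it.
\<close>

definition eigenvalues :: "('a,'b) pre_digraph \<Rightarrow> complex multiset" where
  "eigenvalues G =
     proots (char_poly (adjacency_matrix G (SOME vs. distinct vs \<and> set vs = verts G)))"

definition energy :: "('a,'b) pre_digraph \<Rightarrow> real" where
  "energy G = (\<Sum>\<mu>\<in>#eigenvalues G.
     \<bar>Re \<mu> - real (card (self_loops G)) / real (card (verts G))\<bar>)"

lemma char_poly_adjacency_matrix_relabel:
  assumes "distinct vs" "distinct ws" "set vs = set ws"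
  shows "char_poly (adjacency_matrix G vs) = char_poly (adjacency_matrix G ws)"
proof -
  define n where "n = length vs"
  have n: "length vs = n" "length ws = n"
    using assms by (simp_all add: n_def flip: distinct_card)
  have "\<forall>i<n. \<exists>j<n. vs ! i = ws ! j"
    using assms(3) n by (metis in_set_conv_nth)
  then obtain f where f: "\<And>i. i < n \<Longrightarrow> f i < n" "\<And>i. i < n \<Longrightarrow> vs ! i = ws ! f i"
    by metis
  have inj: "f i = f j \<longleftrightarrow> i = j" if "i < n" "j < n" for i j
    using that f assms(1) n by (metis nth_eq_iff_index_eq)
  define P :: "complex mat" where "P = mat n n (\<lambda>(i, j). if j = f i then 1 else 0)"
  define Q :: "complex mat" where "Q = mat n n (\<lambda>(i, j). if i = f j then 1 else 0)"
  let ?A = "adjacency_matrix G vs" and ?B = "adjacency_matrix G ws"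
  have c: "P \<in> carrier_mat n n" "Q \<in> carrier_mat n n" "?A \<in> carrier_mat n n" "?B \<in> carrier_mat n n"
    by (auto simp: P_def Q_def adjacency_matrix_def n)
  have PQ: "P * Q = 1\<^sub>m n"
  proof (rule eq_matI)
    fix i j assume "i < dim_row (1\<^sub>m n :: complex mat)" "j < dim_col (1\<^sub>m n :: complex mat)"
    hence ij: "i < n" "j < n" by auto
    have "(P * Q) $$ (i, j) = (\<Sum>k<n. (if k = f i then 1 else 0) * (if k = f j then 1 else 0))"
      using ij by (simp add: P_def Q_def scalar_prod_def atLeast0LessThan)
    also have "\<dots> = (\<Sum>k<n. if k = f i then (if f i = f j then 1 else 0) else 0)"
      by (intro sum.cong) auto
    also have "\<dots> = (if f i = f j then 1 else 0)"
      using f(1)[OF ij(1)] by simp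
    finally show "(P * Q) $$ (i, j) = 1\<^sub>m n $$ (i, j)" using ij inj by simp
  qed (auto simp: P_def Q_def)
  have QP: "Q * P = 1\<^sub>m n"
    by (rule mat_mult_left_right_inverse[OF c(1,2) PQ])
  have PB: "P * ?B = mat n n (\<lambda>(i, j). ?B $$ (f i, j))"
  proof (rule eq_matI)
    fix i j assume "i < dim_row (mat n n (\<lambda>(i, j). ?B $$ (f i, j)))"
      "j < dim_col (mat n n (\<lambda>(i, j). ?B $$ (f i, j)))"
    hence ij: "i < n" "j < n" by auto
    have "(P * ?B) $$ (i, j) = (\<Sum>k<n. (if k = f i then 1 else 0) * ?B $$ (k, j))"
      using ij c(4) by (simp add: P_def scalar_prod_def atLeast0LessThan)
    also have "\<dots> = (\<Sum>k<n. if k = f i then ?B $$ (f i, j) else 0)"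
      by (intro sum.cong) auto
    also have "\<dots> = ?B $$ (f i, j)" using f(1)[OF ij(1)] by simp
    finally show "(P * ?B) $$ (i, j) = mat n n (\<lambda>(i, j). ?B $$ (f i, j)) $$ (i, j)"
      using ij by simp
  qed (use c in auto)
  have "?A = P * ?B * Q"
  proof (rule eq_matI)
    fix i j assume "i < dim_row (P * ?B * Q)" "j < dim_col (P * ?B * Q)"
    hence ij: "i < n" "j < n" using c by auto
    have "(P * ?B * Q) $$ (i, j) = (\<Sum>k<n. ?B $$ (f i, k) * (if k = f j then 1 else 0))"
      using ij unfolding PB by (simp add: Q_def scalar_prod_def atLeast0LessThan)
    also have "\<dots> = (\<Sum>k<n. if k = f j then ?B $$ (f i, f j) else 0)"
      by (intro sum.cong) auto
    also have "\<dots> = ?B $$ (f i, f j)" using f(1)[OF ij(2)] by simp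
    finally show "?A $$ (i, j) = (P * ?B * Q) $$ (i, j)"
      using ij f by (simp add: adjacency_matrix_def n)
  qed (use c in auto)
  hence "similar_mat_wit ?A ?B P Q"
    using c PQ QP by (auto simp: similar_mat_wit_def Let_def)
  thus ?thesis
    by (intro char_poly_similar) (auto simp: similar_mat_def)
qed

lemma eigenvalues_eq:
  assumes "distinct vs" "set vs = verts G"
  shows "eigenvalues G = proots (char_poly (adjacency_matrix G vs))"
proof -
  have "distinct (SOME vs. distinct vs \<and> set vs = verts G) \<and>
        set (SOME vs. distinct vs \<and> set vs = verts G) = verts G"
    by (rule someI[of "\<lambda>vs. distinct vs \<and> set vs = verts G" vs]) (use assms in simp)
  thus ?thesis unfolding eigenvalues_def
    using char_poly_adjacency_matrix_relabel[of _ vs] assms by metis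
qed

end

theory Submission
  imports Defs "Jordan_Normal_Form.Schur_Decomposition"
begin

text \<open>
  Ordering the vertices along the condensation of the digraph makes the adjacency matrix block
  triangular, so its spectrum is the union of the spectra of the strong components. Since the
  eigenvalues sum to the number of self-loops, the deviations from the mean cancel, and the energy
  is twice the sum of the positive deviations. For the component \<open>D\<^sub>i\<close> this is at least
  \<open>2 \<Sum>\<^sub>j (Re \<lambda>\<^sub>i\<^sub>j - \<sigma>\<^sub>i / n\<^sub>i)\<close> over any set of indices, in particular over \<open>A\<^sub>i\<close>, whereas
  \<open>E(D)\<close> is exactly \<open>2 \<Sum>\<^sub>i \<Sum>\<^sub>j (Re \<lambda>\<^sub>i\<^sub>j - \<sigma> / n)\<close> with \<open>j\<close> ranging over \<open>A\<^sub>i\<close>.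
\<close>

section \<open>Characteristic polynomials and traces of matrices\<close>

lemma char_poly_four_block_mat_lower_left_zero:
  fixes A :: "'a :: idom mat"
  assumes "A \<in> carrier_mat n n" "B \<in> carrier_mat n m" "D \<in> carrier_mat m m"
  shows "char_poly (four_block_mat A B (0\<^sub>m m n) D) = char_poly A * char_poly D"
proof -
  \<comment> \<open>The variable occurs only on the diagonal, so the zero block survives and
    \<open>B\<close> merely changes sign; the determinant then factors over the diagonal
    blocks.\<close>
  have "char_poly_matrix (four_block_mat A B (0\<^sub>m m n) D) =
      four_block_mat (char_poly_matrix A) (map_mat (\<lambda>a. [:- a:]) B) (0\<^sub>m m n) (char_poly_matrix D)"
    using assms by (intro eq_matI) (auto simp: char_poly_matrix_def)
  thus ?thesis unfolding char_poly_def
    using assms by (subst det_four_block_mat_lower_left_zero[symmetric, of _ n _ m]) auto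
qed

lemma proots_linear_factors:
  fixes as :: "'a :: idom list"
  shows "proots (\<Prod>a\<leftarrow>as. [:- a, 1:]) = mset as"
proof (induction as)
  case (Cons a as)
  have "(\<Prod>a\<leftarrow>as. [:- a, 1:]) \<noteq> 0" by (auto simp: prod_list_zero_iff)
  with Cons show ?case by (simp add: proots_mult del: mult_pCons_left)
qed simp

lemma sum_diag_mult_commute:
  fixes M N :: "'a :: comm_semiring_0 mat"
  assumes "M \<in> carrier_mat n n" "N \<in> carrier_mat n n"
  shows "(\<Sum>i<n. (M * N) $$ (i, i)) = (\<Sum>i<n. (N * M) $$ (i, i))"
proof -
  have "(\<Sum>i<n. (M * N) $$ (i, i)) = (\<Sum>i<n. \<Sum>k<n. M $$ (i, k) * N $$ (k, i))"
    using assms by (intro sum.cong) (auto simp: scalar_prod_def atLeast0LessThan)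
  also have "\<dots> = (\<Sum>k<n. \<Sum>i<n. N $$ (k, i) * M $$ (i, k))"
    by (subst sum.swap) (simp add: mult.commute)
  also have "\<dots> = (\<Sum>k<n. (N * M) $$ (k, k))"
    using assms by (intro sum.cong) (auto simp: scalar_prod_def atLeast0LessThan)
  finally show ?thesis .
qed

text \<open>By Schur decomposition \<open>A\<close> is similar to an upper triangular matrix whose
  diagonal lists the roots with multiplicity, and similarity preserves the trace.\<close>

lemma sum_proots_char_poly:
  fixes A :: "complex mat"
  assumes A: "A \<in> carrier_mat n n"
  shows "\<Sum>\<^sub># (proots (char_poly A)) = (\<Sum>i<n. A $$ (i, i))"
proof -
  obtain as where "char_poly A = (\<Prod>a\<leftarrow>as. [:- a, 1:])"
    using char_poly_factorized[OF A] by blast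
  then obtain B where B: "B \<in> carrier_mat n n" "upper_triangular B" "similar_mat A B"
    using schur_decomposition_exists[OF A] by blast
  then obtain P Q where "similar_mat_wit A B P Q"
    by (auto simp: similar_mat_def)
  from similar_mat_witD2[OF A this]
  have PQ: "P \<in> carrier_mat n n" "Q \<in> carrier_mat n n" "Q * P = 1\<^sub>m n" "A = P * B * Q"
    by auto
  have "proots (char_poly A) = proots (\<Prod>a\<leftarrow>diag_mat B. [:- a, 1:])"
    using char_poly_similar[OF B(3)] char_poly_upper_triangular[OF B(1,2)] by simp
  also have "\<dots> = mset (diag_mat B)"
    by (rule proots_linear_factors)
  finally have "\<Sum>\<^sub># (proots (char_poly A)) = (\<Sum>i<n. B $$ (i, i))"
    using B(1) by (simp add: diag_mat_def sum_unfold_sum_mset atLeast0LessThan)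
  \<comment> \<open>Inserting \<open>Q * P = 1\<close> lets the trace be rotated into that of
    \<open>P * B * Q\<close>, which is \<open>A\<close>.\<close>
  also have "\<dots> = (\<Sum>i<n. ((Q * P) * B) $$ (i, i))"
    using B(1) PQ(3) by simp
  also have "\<dots> = (\<Sum>i<n. (Q * (P * B)) $$ (i, i))"
    by (simp only: assoc_mult_mat[OF PQ(2,1) B(1)])
  also have "\<dots> = (\<Sum>i<n. (P * B * Q) $$ (i, i))"
    using B(1) PQ(1,2) by (intro sum_diag_mult_commute) auto
  finally show ?thesis using PQ(4) by simp
qed

section \<open>Block triangular adjacency matrices\<close>

lemma adjacency_matrix_carrier [simp]:
  "adjacency_matrix G vs \<in> carrier_mat (length vs) (length vs)"
  by (simp add: adjacency_matrix_def)

lemma char_poly_adjacency_matrix_nonzero: "char_poly (adjacency_matrix G vs) \<noteq> 0"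
  using degree_monic_char_poly[OF adjacency_matrix_carrier, of G vs] by auto

lemma char_poly_adjacency_matrix_append:
  assumes "\<And>w v. w \<in> set ws \<Longrightarrow> v \<in> set vs \<Longrightarrow> (w, v) \<notin> arcs_ends G"
  shows "char_poly (adjacency_matrix G (vs @ ws)) =
    char_poly (adjacency_matrix G vs) * char_poly (adjacency_matrix G ws)"
proof -
  let ?B = "mat (length vs) (length ws)
     (\<lambda>(i, j). if (vs ! i, ws ! j) \<in> arcs_ends G then 1 else 0) :: complex mat"
  have "adjacency_matrix G (vs @ ws) = four_block_mat (adjacency_matrix G vs) ?B
      (0\<^sub>m (length ws) (length vs)) (adjacency_matrix G ws)"
    using assms by (intro eq_matI) (auto simp: adjacency_matrix_def nth_append)
  thus ?thesis
    by (simp add: char_poly_four_block_mat_lower_left_zero[of _ "length vs" _ "length ws"])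
qed

text \<open>The rank \<open>r\<close> drops along every arc between different blocks. A block
  \<open>x\<close> of maximal rank therefore receives no arc from the others; listing it first makes
  the matrix block upper triangular, and induction treats the remaining blocks.\<close>

lemma char_poly_adjacency_matrix_layered:
  fixes r :: "'i \<Rightarrow> nat"
  assumes "finite I"
    and "\<And>i. i \<in> I \<Longrightarrow> distinct (vs i)"
    and "\<And>i j. i \<in> I \<Longrightarrow> j \<in> I \<Longrightarrow> i \<noteq> j \<Longrightarrow> set (vs i) \<inter> set (vs j) = {}"
    and "\<And>i j u v. i \<in> I \<Longrightarrow> j \<in> I \<Longrightarrow> i \<noteq> j \<Longrightarrow> u \<in> set (vs i) \<Longrightarrow> v \<in> set (vs j) \<Longrightarrow>
           (u, v) \<in> arcs_ends G \<Longrightarrow> r j < r i"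
    and "distinct ws" "set ws = (\<Union>i\<in>I. set (vs i))"
  shows "char_poly (adjacency_matrix G ws) = (\<Prod>i\<in>I. char_poly (adjacency_matrix G (vs i)))"
  using assms
proof (induction I arbitrary: ws rule: finite_ranking_induct[where f = r])
  case empty
  thus ?case by (simp add: adjacency_matrix_def char_poly_def)
next
  case (insert x I)
  show ?case
  \<comment> \<open>The ranking induction does not ensure that the inserted element is new.\<close>
  proof (cases "x \<in> I")
    case True
    have "insert x I = I" using True by blast
    thus ?thesis using insert.IH insert.prems by metis
  next
    case False
    obtain us where us: "set us = (\<Union>i\<in>I. set (vs i))" "distinct us"
      using finite_distinct_list[of "\<Union>i\<in>I. set (vs i)"] insert.hyps(1) by auto
    have IH: "char_poly (adjacency_matrix G us) = (\<Prod>i\<in>I. char_poly (adjacency_matrix G (vs i)))"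
      using us insert.prems(1-3) by (intro insert.IH) auto
    have disj: "set (vs x) \<inter> set us = {}"
      using insert.prems(2)[of x] False unfolding us(1) by blast
    \<comment> \<open>Independence of the labelling allows the vertices of block \<open>x\<close> to
      be moved to the front.\<close>
    have "char_poly (adjacency_matrix G ws) = char_poly (adjacency_matrix G (vs x @ us))"
      using insert.prems us disj by (intro char_poly_adjacency_matrix_relabel) auto
    also have "\<dots> = char_poly (adjacency_matrix G (vs x)) * char_poly (adjacency_matrix G us)"
    proof (rule char_poly_adjacency_matrix_append, rule notI)
      fix w v assume "w \<in> set us" "v \<in> set (vs x)" "(w, v) \<in> arcs_ends G"
      then obtain i where i: "i \<in> I" "w \<in> set (vs i)" using us(1) by blast
      have "r x < r i"
        by (rule insert.prems(3)[of i x w v]) (use i False in \<open>auto simp: \<open>v \<in> _\<close> \<open>(w, v) \<in> _\<close>\<close>)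
      thus False using insert.hyps(2)[OF i(1)] by simp
    qed
    finally show ?thesis using IH False insert.hyps(1) by simp
  qed
qed

section \<open>Spectrum of a digraph and of its strong components\<close>

context fin_digraph
begin

text \<open>Supplies the rank that orders the components. Whatever \<open>d\<close> reaches,
  \<open>c\<close> reaches through the arc; the inclusion is proper because \<open>u\<close> reached
  from \<open>d\<close> would put \<open>u\<close> and \<open>v\<close> into one component.\<close>

lemma card_reachable_less:
  assumes "c \<in> sccs" "d \<in> sccs" "c \<noteq> d" "u \<in> verts c" "v \<in> verts d" "(u, v) \<in> arcs_ends G"
  shows "card {w. \<exists>x\<in>verts d. x \<rightarrow>\<^sup>* w} < card {w. \<exists>x\<in>verts c. x \<rightarrow>\<^sup>* w}"
proof (rule psubset_card_mono)
  have S: "verts c \<in> sccs_verts" "verts d \<in> sccs_verts"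
    using assms by (auto simp: sccs_verts_conv)
  have ne: "verts c \<noteq> verts d"
    using inj_on_verts_sccs assms by (auto dest: inj_onD)
  have uv: "u \<rightarrow>\<^sup>* v" using assms(6) by blast
  show "finite {w. \<exists>x\<in>verts c. x \<rightarrow>\<^sup>* w}"
    by (rule finite_subset[of _ "verts G"]) (auto dest: reachable_in_verts)
  have d: "v \<rightarrow>\<^sup>* x" if "x \<in> verts d" for x
    using S(2) that assms(5) unfolding in_sccs_verts_conv_reachable by meson
  have "u \<rightarrow>\<^sup>* w" if "x \<in> verts d" "x \<rightarrow>\<^sup>* w" for x w
    using reachable_trans[OF reachable_trans[OF uv d] that(2)] that(1) .
  moreover have "u \<rightarrow>\<^sup>* u"
    using reachable_in_verts(1)[OF uv] by simp
  moreover have "\<not> x \<rightarrow>\<^sup>* u" if "x \<in> verts d" for x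
  proof
    assume "x \<rightarrow>\<^sup>* u"
    hence "v \<rightarrow>\<^sup>* u"
      by (rule reachable_trans[OF d[OF that]])
    hence "v \<in> verts c"
      using S(1) assms(4) uv unfolding in_sccs_verts_conv_reachable by meson
    thus False using sccs_verts_disjoint[OF S ne] assms(5) by blast
  qed
  ultimately show "{w. \<exists>x\<in>verts d. x \<rightarrow>\<^sup>* w} \<subset> {w. \<exists>x\<in>verts c. x \<rightarrow>\<^sup>* w}"
    using assms(4) by blast
qed

lemma finite_verts_scc: "c \<in> sccs \<Longrightarrow> finite (verts c)"
  by (rule finite_subset[OF sccs_verts_subsets finite_verts]) (simp add: sccs_verts_conv)

theorem eigenvalues_eq_sum_sccs: "eigenvalues G = (\<Sum>c\<in>sccs. eigenvalues c)"
proof -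
  have "\<forall>c\<in>sccs. \<exists>vs. set vs = verts c \<and> distinct vs"
    using finite_verts_scc finite_distinct_list by blast
  then obtain vs where vs: "\<And>c. c \<in> sccs \<Longrightarrow> set (vs c) = verts c"
      "\<And>c. c \<in> sccs \<Longrightarrow> distinct (vs c)"
    by metis
  obtain ws where ws: "set ws = verts G" "distinct ws"
    using finite_distinct_list[OF finite_verts] by blast
  have fin: "finite sccs"
    using finite_sccs_verts inj_on_verts_sccs by (auto simp: sccs_verts_conv dest: finite_imageD)
  have "\<Union> sccs_verts = verts G"
    using sccs_verts_subsets scc_of_in_sccs_verts in_scc_of_self by blast
  hence union: "(\<Union>c\<in>sccs. verts c) = verts G"
    by (simp add: sccs_verts_conv)
  \<comment> \<open>Components are induced subgraphs, so no arc or self-loop between their vertices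
    is lost.\<close>
  have adj: "adjacency_matrix c (vs c) = adjacency_matrix G (vs c)" if "c \<in> sccs" for c
  proof -
    have ind: "induced_subgraph c G" using that by (rule in_sccs_imp_induced)
    hence "tail c = tail G" "head c = head G"
      by (auto simp: induced_subgraph_def subgraph_def compatible_def)
    hence "(u, v) \<in> arcs_ends c \<longleftrightarrow> (u, v) \<in> arcs_ends G" if "u \<in> verts c" "v \<in> verts c" for u v
      using ind that by (auto simp: induced_subgraph_def arcs_ends_conv)
    thus ?thesis
      by (intro eq_matI) (auto simp: adjacency_matrix_def simp flip: vs(1)[OF that])
  qed
  have "char_poly (adjacency_matrix G ws) = (\<Prod>c\<in>sccs. char_poly (adjacency_matrix G (vs c)))"
  proof (rule char_poly_adjacency_matrix_layered[OF fin,
      where r = "\<lambda>c. card {w. \<exists>x\<in>verts c. x \<rightarrow>\<^sup>* w}"])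
    fix c d assume "c \<in> sccs" "d \<in> sccs" "c \<noteq> d"
    thus "set (vs c) \<inter> set (vs d) = {}"
      using vs(1) sccs_verts_disjoint[of "verts c" "verts d"] inj_on_verts_sccs
      by (auto simp: sccs_verts_conv dest: inj_onD)
  qed (use vs ws union card_reachable_less in auto)
  hence "eigenvalues G = (\<Sum>c\<in>sccs. proots (char_poly (adjacency_matrix G (vs c))))"
    using ws by (simp add: eigenvalues_eq[of ws] proots_prod char_poly_adjacency_matrix_nonzero)
  also have "\<dots> = (\<Sum>c\<in>sccs. eigenvalues c)"
    by (intro sum.cong) (simp_all add: adj eigenvalues_eq[OF vs(2,1)])
  finally show ?thesis .
qed

end

section \<open>Energy as twice the sum of positive deviations\<close>

lemma size_eigenvalues:
  assumes "finite (verts G)"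
  shows "size (eigenvalues G) = card (verts G)"
proof -
  obtain vs where vs: "set vs = verts G" "distinct vs"
    using finite_distinct_list[OF assms] by blast
  show ?thesis
    using vs degree_monic_char_poly[OF adjacency_matrix_carrier, of G vs]
    by (simp add: eigenvalues_eq[of vs] size_proots_complex flip: distinct_card)
qed

text \<open>Both sides are the trace of the adjacency matrix, whose diagonal marks the
  self-loops.\<close>

lemma sum_eigenvalues:
  assumes "finite (verts G)"
  shows "\<Sum>\<^sub># (eigenvalues G) = of_nat (card (self_loops G))"
proof -
  obtain vs where vs: "set vs = verts G" "distinct vs"
    using finite_distinct_list[OF assms] by blast
  have "\<Sum>\<^sub># (eigenvalues G) = (\<Sum>i<length vs. adjacency_matrix G vs $$ (i, i))"
    using vs by (simp add: eigenvalues_eq[of vs] sum_proots_char_poly[OF adjacency_matrix_carrier])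
  also have "\<dots> = (\<Sum>i<length vs. if (vs ! i, vs ! i) \<in> arcs_ends G then 1 else 0)"
    by (intro sum.cong) (auto simp: adjacency_matrix_def)
  also have "\<dots> = (\<Sum>v\<in>verts G. if (v, v) \<in> arcs_ends G then 1 else 0)"
    using sum.reindex_bij_betw[OF bij_betw_nth[OF vs(2) refl refl],
        of "\<lambda>v. if (v, v) \<in> arcs_ends G then 1 else 0 :: complex"] vs(1) by simp
  also have "\<dots> = of_nat (card (self_loops G))"
    using assms by (simp add: self_loops_def sum.If_cases Int_def)
  finally show ?thesis .
qed

lemma Re_sum_mset: "Re (\<Sum>\<^sub># M) = (\<Sum>z\<in>#M. Re z)"
  by (induction M) auto

lemma energy_eq_positive_part:
  assumes "finite (verts G)" "verts G \<noteq> {}"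
  shows "energy G =
    2 * (\<Sum>\<mu>\<in>#eigenvalues G. max 0 (Re \<mu> - real (card (self_loops G)) / real (card (verts G))))"
proof -
  define c where "c = real (card (self_loops G)) / real (card (verts G))"
  \<comment> \<open>This sums \<open>\<bar>x\<bar> = 2 * max 0 x - x\<close>. The subtracted total
    deviation vanishes for the spectrum, because \<open>c\<close> is the mean of the real
    parts.\<close>
  have dev: "(\<Sum>\<mu>\<in>#M. \<bar>Re \<mu> - c\<bar>) =
      2 * (\<Sum>\<mu>\<in>#M. max 0 (Re \<mu> - c)) - ((\<Sum>\<mu>\<in>#M. Re \<mu>) - real (size M) * c)" for M
    by (induction M) (auto simp: max_def algebra_simps)
  have "real (card (verts G)) \<noteq> 0" using assms by simp
  hence "(\<Sum>\<mu>\<in>#eigenvalues G. Re \<mu>) - real (size (eigenvalues G)) * c = 0"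
    using assms(1) by (simp add: size_eigenvalues sum_eigenvalues c_def flip: Re_sum_mset)
  thus ?thesis using dev[of "eigenvalues G"] by (simp add: energy_def c_def)
qed

lemma sum_mset_sum:
  assumes "finite I"
  shows "\<Sum>\<^sub># (image_mset f (\<Sum>i\<in>I. M i)) = (\<Sum>i\<in>I. \<Sum>\<^sub># (image_mset f (M i)))"
  using assms by (induction I rule: finite_induct) auto

section \<open>Comparison of the energies\<close>

theorem theorem3p9:
  fixes D :: "'a pair_pre_digraph"
    and C :: "nat \<Rightarrow> ('a, 'a \<times> 'a) pre_digraph"
    and ev :: "nat \<Rightarrow> nat \<Rightarrow> complex"
    and A :: "nat \<Rightarrow> nat set"
    and n \<sigma> k l :: nat
    and n\<^sub>c \<sigma>\<^sub>c :: "nat \<Rightarrow> nat"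
  assumes "pair_fin_digraph D" and "pverts D \<noteq> {}"
    and "n = card (verts (with_proj D))"
    and "\<sigma> = card (self_loops (with_proj D))"
    and "bij_betw C {1..k} (pre_digraph.sccs (with_proj D))"
    and "\<And>i. i \<in> {1..k} \<Longrightarrow> n\<^sub>c i = card (verts (C i))"
    and "\<And>i. i \<in> {1..k} \<Longrightarrow> \<sigma>\<^sub>c i = card (self_loops (C i))"
    and "n = (\<Sum>i=1..k. n\<^sub>c i)"
    and "\<sigma> = (\<Sum>i=1..k. \<sigma>\<^sub>c i)"
    and "\<And>i. i \<in> {1..k} \<Longrightarrow> eigenvalues (C i) = image_mset (ev i) (mset_set {1..n\<^sub>c i})"
    and "1 \<le> l" and "l < k"
    and "\<And>i. i \<in> {1..l} \<Longrightarrow> real (\<sigma>\<^sub>c i) / real (n\<^sub>c i) > real \<sigma> / real n"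
    and "\<And>i. i \<in> {l+1..k} \<Longrightarrow> real (\<sigma>\<^sub>c i) / real (n\<^sub>c i) \<le> real \<sigma> / real n"
    and "\<And>i. i \<in> {1..k} \<Longrightarrow> A i = {j \<in> {1..n\<^sub>c i}. Re (ev i j) > real \<sigma> / real n}"
  shows "((\<Sum>i=1..l. (real (\<sigma>\<^sub>c i) / real (n\<^sub>c i) - real \<sigma> / real n) * real (card (A i)))
            \<le> (\<Sum>i=l+1..k. (real \<sigma> / real n - real (\<sigma>\<^sub>c i) / real (n\<^sub>c i)) * real (card (A i)))
          \<longrightarrow> energy (with_proj D) \<le> (\<Sum>i=1..k. energy (C i)))
       \<and> ((\<Sum>i=1..l. (real (\<sigma>\<^sub>c i) / real (n\<^sub>c i) - real \<sigma> / real n) * real (card (A i)))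
            < (\<Sum>i=l+1..k. (real \<sigma> / real n - real (\<sigma>\<^sub>c i) / real (n\<^sub>c i)) * real (card (A i)))
          \<longrightarrow> energy (with_proj D) < (\<Sum>i=1..k. energy (C i)))"
proof -
  interpret pair_fin_digraph D by fact
  let ?G = "with_proj D"
  define s where "s = real \<sigma> / real n"
  define c where "c i = real (\<sigma>\<^sub>c i) / real (n\<^sub>c i)" for i
  \<comment> \<open>\<open>X\<close> will turn out to be half the energy of \<open>D\<close>: the
    sets \<open>A i\<close> collect exactly the positive deviations from \<open>s\<close>.\<close>
  define X where "X = (\<Sum>i=1..k. \<Sum>j\<in>A i. Re (ev i j) - s)"
  have scc: "C i \<in> sccs" if "i \<in> {1..k}" for i
    using assms(5) that by (auto simp: bij_betw_def)
  have "eigenvalues ?G = (\<Sum>d\<in>sccs. eigenvalues d)"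
    by (rule eigenvalues_eq_sum_sccs)
  also have "\<dots> = (\<Sum>i\<in>{1..k}. eigenvalues (C i))"
    by (rule sum.reindex_bij_betw[OF assms(5), symmetric])
  finally have spec: "eigenvalues ?G = (\<Sum>i\<in>{1..k}. eigenvalues (C i))" .
  have "energy ?G = 2 * (\<Sum>\<mu>\<in>#eigenvalues ?G. max 0 (Re \<mu> - s))"
    using assms(2) by (subst energy_eq_positive_part) (auto simp: s_def assms(3,4))
  also have "\<dots> = 2 * (\<Sum>i\<in>{1..k}. \<Sum>\<mu>\<in>#eigenvalues (C i). max 0 (Re \<mu> - s))"
    by (simp add: spec sum_mset_sum)
  also have "(\<Sum>i\<in>{1..k}. \<Sum>\<mu>\<in>#eigenvalues (C i). max 0 (Re \<mu> - s)) = X"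
    unfolding X_def
  proof (rule sum.cong)
    fix i assume i: "i \<in> {1..k}"
    have "(\<Sum>\<mu>\<in>#eigenvalues (C i). max 0 (Re \<mu> - s)) = (\<Sum>j\<in>{1..n\<^sub>c i}. max 0 (Re (ev i j) - s))"
      by (simp add: assms(10)[OF i] sum_unfold_sum_mset multiset.map_comp o_def)
    also have "\<dots> = (\<Sum>j\<in>A i. Re (ev i j) - s)"
      by (rule sum.mono_neutral_cong_right) (auto simp: assms(15)[OF i] s_def)
    finally show "(\<Sum>\<mu>\<in>#eigenvalues (C i). max 0 (Re \<mu> - s)) = (\<Sum>j\<in>A i. Re (ev i j) - s)" .
  qed simp
  finally have ED: "energy ?G = 2 * X" .
  \<comment> \<open>Moving the reference point from \<open>s\<close> to \<open>c i\<close> changes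
    each of the \<open>card (A i)\<close> terms by \<open>s - c i\<close>. It is only an inequality
    since \<open>A i\<close> is cut off at \<open>s\<close>, not at \<open>c i\<close>.\<close>
  have EC: "energy (C i) \<ge> 2 * ((\<Sum>j\<in>A i. Re (ev i j) - s) + (s - c i) * real (card (A i)))"
    if i: "i \<in> {1..k}" for i
  proof -
    have "verts (C i) \<noteq> {}"
      using scc[OF i] by (auto simp: sccs_def strongly_connected_def)
    hence "energy (C i) = 2 * (\<Sum>\<mu>\<in>#eigenvalues (C i). max 0 (Re \<mu> - c i))"
      using finite_verts_scc[OF scc[OF i]] energy_eq_positive_part[of "C i"]
      by (simp add: c_def assms(6,7)[OF i])
    also have "(\<Sum>\<mu>\<in>#eigenvalues (C i). max 0 (Re \<mu> - c i)) = (\<Sum>j\<in>{1..n\<^sub>c i}. max 0 (Re (ev i j) - c i))"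
      by (simp add: assms(10)[OF i] sum_unfold_sum_mset multiset.map_comp o_def)
    finally have E: "energy (C i) = 2 * (\<Sum>j\<in>{1..n\<^sub>c i}. max 0 (Re (ev i j) - c i))" .
    have "(\<Sum>j\<in>A i. Re (ev i j) - s) + (s - c i) * real (card (A i)) = (\<Sum>j\<in>A i. Re (ev i j) - c i)"
      by (simp add: sum_subtractf algebra_simps)
    also have "\<dots> \<le> (\<Sum>j\<in>A i. max 0 (Re (ev i j) - c i))"
      by (intro sum_mono) simp
    also have "\<dots> \<le> (\<Sum>j\<in>{1..n\<^sub>c i}. max 0 (Re (ev i j) - c i))"
      by (intro sum_mono2) (auto simp: assms(15)[OF i])
    finally show ?thesis using E by simp
  qed
  have split: "{1..k} = {1..l} \<union> {l+1..k}" using assms(12) by auto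
  \<comment> \<open>The total correction is the right side minus the left side of the assumed
    inequality. The component energies thus exceed \<open>2 * X\<close> by at least twice this
    difference, which settles the weak and the strict claim together.\<close>
  have "(\<Sum>i=1..k. (s - c i) * real (card (A i))) =
      (\<Sum>i=l+1..k. (s - c i) * real (card (A i))) - (\<Sum>i=1..l. (c i - s) * real (card (A i)))"
    unfolding split by (subst sum.union_disjoint) (auto simp: algebra_simps sum_subtractf)
  moreover have "(\<Sum>i=1..k. energy (C i)) \<ge>
      (\<Sum>i=1..k. 2 * ((\<Sum>j\<in>A i. Re (ev i j) - s) + (s - c i) * real (card (A i))))"
    by (intro sum_mono EC)
  moreover have "(\<Sum>i=1..k. 2 * ((\<Sum>j\<in>A i. Re (ev i j) - s) + (s - c i) * real (card (A i)))) =
      2 * X + 2 * (\<Sum>i=1..k. (s - c i) * real (card (A i)))"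
    by (simp add: X_def sum.distrib flip: sum_distrib_left)
  ultimately show ?thesis
    unfolding ED s_def[symmetric] c_def[symmetric] by linarith
qed

end
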